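(* Let $ABC$ be a triangle with side lengths $a=BC$, $b=AC$, $c=AB$, and let $w,w_A,w_B,w_C$ be the quantities associated to its centroid $G$. Then: (i) If $a\ge b\ge c$, then \[ w_A=\begin{cases}\dfrac b3+\dfrac c3+\dfrac{2\sqrt{bc}}3, & \text{for } b\le 4c,\\[2mm] c+\dfrac b2, & \text{for } b>4c,\end{cases} \qquad w_B=\begin{cases}\dfrac a3+\dfrac c3+\dfrac{2\sqrt{ac}}3, & \text{for } a\le 4c,\\[2mm] c+\dfrac a2, & \text{for } a>4c,\end{cases} \] \[ w_C=\frac a3+\frac b3+\frac{2\sqrt{ab}}3 . \] (ii) If $a\ge b\ge c$, then $w_A\le w_B\le w_C$. In particular, $w=w_A$. (iii) $w\le \dfrac{4(a+b+c)}{9}$, with equality if and only if $a=b=c$.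
   Context: Let $G$ be the centroid of the (nondegenerate) triangle $ABC$. $w_A$ is the minimum of $AM+AN$ over all chords $MN$ of the triangle passing through $G$ with $M$ on the segment $AB$ and $N$ on the segment $AC$ (endpoints allowed); $w_B$ is the minimum of $BM+BN$ over all chords $MN$ through $G$ with $M$ on the segment $AB$ and $N$ on the segment $BC$; $w_C$ is the minimum of $CM+CN$ over all chords $MN$ through $G$ with $M$ on the segment $AC$ and $N$ on the segment $BC$. Each line through $G$ meets the boundary of the triangle in two points, dividing the perimeter into two parts (polygonal arcs); $w$ is the length of the smallest part of the perimeter determined by a variable line through $G$, i.e. the minimum over all lines through $G$ of the lengths of the two parts. *)

theory Defs
  imports "HOL-Analysis.Analysis"
begin

definition centroid :: "real^2 \<Rightarrow> real^2 \<Rightarrow> real^2 \<Rightarrow> real^2" where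
  "centroid A B C = (1/3) *\<^sub>R (A + B + C)"

definition corner_sums :: "real^2 \<Rightarrow> real^2 \<Rightarrow> real^2 \<Rightarrow> real set" where
  "corner_sums V P Q =
     {dist V M + dist V N | M N.
        M \<in> closed_segment V P \<and> N \<in> closed_segment V Q \<and>
        centroid V P Q \<in> closed_segment M N}"

definition perimeter :: "real^2 \<Rightarrow> real^2 \<Rightarrow> real^2 \<Rightarrow> (real^2) set" where
  "perimeter A B C = closed_segment A B \<union> closed_segment B C \<union> closed_segment C A"

(* One-dimensional measure of the part of the segment PQ lying in S: linepath P Q has
   constant speed dist P Q on [0,1]. *)
definition length_on_side :: "real^2 \<Rightarrow> real^2 \<Rightarrow> (real^2) set \<Rightarrow> real" where
  "length_on_side P Q S = dist P Q * measure lborel {t \<in> {0..1}. linepath P Q t \<in> S}"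

definition perimeter_length :: "real^2 \<Rightarrow> real^2 \<Rightarrow> real^2 \<Rightarrow> (real^2) set \<Rightarrow> real" where
  "perimeter_length A B C S =
     length_on_side A B S + length_on_side B C S + length_on_side C A S"

(* The two parts into which a line L divides the perimeter are the connected components that
   remain once the points of L are removed. They are arcs without their two endpoints, which
   does not affect their length. *)
definition part_lengths :: "real^2 \<Rightarrow> real^2 \<Rightarrow> real^2 \<Rightarrow> real set" where
  "part_lengths A B C =
     {perimeter_length A B C S | L S.
        affine L \<and> aff_dim L = 1 \<and> centroid A B C \<in> L \<and>
        S \<in> components (perimeter A B C - L)}"

definition has_minimum :: "real set \<Rightarrow> bool" where
  "has_minimum X \<longleftrightarrow> (\<exists>m\<in>X. \<forall>x\<in>X. m \<le> x)"

(* Meaningful only if has_minimum X. *)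
definition minimum :: "real set \<Rightarrow> real" where
  "minimum X = (LEAST m. m \<in> X)"

end

theory Submission
  imports Defs
begin

text \<open>If a chord through the centroid cuts the sides \<open>VP\<close> and \<open>VQ\<close> in the ratios \<open>s\<close> and \<open>t\<close>
  (measured from \<open>V\<close>), then \<open>1/s + 1/t = 3\<close>. With \<open>x = 3 s - 1\<close> this reads \<open>3 t - 1 = 1/x\<close>, where
  \<open>x\<close> ranges over \<open>[1/2, 2]\<close>, and the sum of the two cut-off lengths becomes
  \<open>(p + q + p x + q/x) / 3\<close>; its minimum is given by AM-GM or lies at an endpoint, and is
  monotone in \<open>p\<close> and \<open>q\<close>. A part of the perimeter containing one vertex is such a sum. A part
  containing two vertices is no shorter than one of the two parts obtained when the line is a
  median, and these are again such sums at other corners, so \<open>w\<close> is the least of the three corner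
  minima. Averaging the bounds \<open>2 (p + q) / 3\<close> from the chords parallel to a side gives (iii).\<close>

section \<open>Chord sums at a corner as a one-variable minimisation\<close>

definition sweep :: "real \<Rightarrow> real \<Rightarrow> real set" where
  "sweep p q = (\<lambda>x. (p + q + p * x + q / x) / 3) ` {1/2..2}"

text \<open>The unconstrained minimiser of the sum is \<open>x = sqrt (q / p)\<close>. The first two
  branches are the values at \<open>x = 2\<close> and \<open>x = 1/2\<close>, taken when this point
  lies beyond that end of the interval.\<close>

definition least_chord :: "real \<Rightarrow> real \<Rightarrow> real" where
  "least_chord p q =
     (if q > 4 * p then p + q / 2
      else if p > 4 * q then q + p / 2
      else p / 3 + q / 3 + 2 * sqrt (p * q) / 3)"

text \<open>This is the proportion of a segment on which an affine function with end values
  \<open>x\<close> and \<open>y\<close> is positive. When both are zero, division by zero yields 0,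
  which is the right value.\<close>

definition positive_fraction :: "real \<Rightarrow> real \<Rightarrow> real" where
  "positive_fraction x y = (max x 0 + max y 0) / (\<bar>x\<bar> + \<bar>y\<bar>)"

lemma minimum_eqI:
  assumes "m \<in> X" "\<And>x. x \<in> X \<Longrightarrow> m \<le> x"
  shows "has_minimum X" "minimum X = m"
  using assms by (auto simp: has_minimum_def minimum_def intro!: Least_equality)

lemma sweepI: "x \<in> {1/2..2} \<Longrightarrow> k = (p + q + p * x + q / x) / 3 \<Longrightarrow> k \<in> sweep p q"
  by (auto simp: sweep_def)

text \<open>The substitution of \<open>1 / x\<close> for \<open>x\<close> preserves the interval and
  exchanges \<open>p\<close> and \<open>q\<close>.\<close>

lemma sweep_commute: "sweep p q = sweep q p"
proof -
  have "sweep p q \<subseteq> sweep q p" for p q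
  proof
    fix k assume "k \<in> sweep p q"
    then obtain x where x: "x \<in> {1/2..2}" "k = (p + q + p * x + q / x) / 3"
      by (auto simp: sweep_def)
    then have "1 / x \<in> {1/2..2}" by (auto simp: field_simps)
    then show "k \<in> sweep q p"
      using x by (intro sweepI[of "1 / x"]) (auto simp: add_ac)
  qed
  then show ?thesis by blast
qed

lemma least_chord_commute:
  assumes "p > 0" "q > 0" shows "least_chord p q = least_chord q p"
  using assms by (auto simp: least_chord_def mult.commute)

text \<open>The chord is the median from the far end of the side of length \<open>q\<close>.\<close>

lemma median_in_sweep: "p / 2 + q \<in> sweep p q"
  by (rule sweepI[of "1/2"]) (auto simp: field_simps)

text \<open>The chord is parallel to the third side and cuts both sides in the ratio 2/3.\<close>

lemma parallel_in_sweep: "2 * (p + q) / 3 \<in> sweep p q"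
  by (rule sweepI[of 1]) (auto simp: field_simps)

lemma least_chord_in_sweep:
  assumes "p > 0" "q > 0" shows "least_chord p q \<in> sweep p q"
proof -
  consider "q > 4 * p" | "p > 4 * q" | "q \<le> 4 * p" "p \<le> 4 * q" by linarith
  then show ?thesis
  proof cases
    case 1
    then show ?thesis using median_in_sweep[of q p] assms
      by (simp add: least_chord_def sweep_commute[of p] add.commute)
  next
    case 2
    then show ?thesis using median_in_sweep[of p q] assms
      by (simp add: least_chord_def add.commute)
  next
    case 3
    \<comment> \<open>The minimiser becomes \<open>v / u\<close>, and the two case bounds say
      exactly that it lies between 1/2 and 2.\<close>
    define u v where "u = sqrt p" and "v = sqrt q"
    have uv: "u > 0" "v > 0" "p = u^2" "q = v^2" using assms by (auto simp: u_def v_def)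
    have "v\<^sup>2 \<le> (2 * u)\<^sup>2" "u\<^sup>2 \<le> (2 * v)\<^sup>2"
      using 3 uv by (simp_all add: power_mult_distrib)
    then have "v \<le> 2 * u" "u \<le> 2 * v"
      using uv by (auto intro: power2_le_imp_le)
    then have "v / u \<in> {1/2..2}" using uv by (auto simp: field_simps)
    then show ?thesis using 3 uv
      by (intro sweepI[of "v / u"])
        (auto simp: least_chord_def real_sqrt_mult field_simps power2_eq_square)
  qed
qed

lemma least_chord_le_aux:
  assumes "p > 0" "q > 0" "p \<le> 4 * q" "k \<in> sweep p q"
  shows "least_chord p q \<le> k"
proof -
  obtain x where x: "1/2 \<le> x" "x \<le> 2" and k: "k = (p + q + p * x + q / x) / 3"
    using assms(4) by (auto simp: sweep_def)
  show ?thesis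
  proof (cases "q > 4 * p")
    case True
    \<comment> \<open>This product is twice the gap between the sum at \<open>x\<close> and its
      value at 2, after multiplication by \<open>3 * x\<close>. The second factor is nonnegative
      because \<open>q > 4 * p\<close> and \<open>x \<le> 2\<close>.\<close>
    have "0 \<le> (2 - x) * (q - 2 * p * x)"
    proof -
      have "p * x \<le> p * 2" using assms x by (intro mult_left_mono) auto
      then show ?thesis using True x by (intro mult_nonneg_nonneg) auto
    qed
    then have "(p + q / 2) * 3 * x \<le> (p + q + p * x + q / x) * x"
      using x by (simp add: algebra_simps)
    then have "(p + q / 2) * 3 \<le> p + q + p * x + q / x"
      by (rule mult_right_le_imp_le) (use x in simp)
    then show ?thesis using True k by (simp add: least_chord_def)
  next
    case False
    have "0 \<le> (sqrt (p * x) - sqrt (q / x))^2" by simp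
    also have "\<dots> = p * x + q / x - 2 * (sqrt (p * x) * sqrt (q / x))"
      using assms x by (simp add: power2_diff)
    also have "sqrt (p * x) * sqrt (q / x) = sqrt (p * q)"
      using x by (simp flip: real_sqrt_mult)
    finally show ?thesis using False assms k by (simp add: least_chord_def)
  qed
qed

lemma least_chord_le:
  assumes "p > 0" "q > 0" "k \<in> sweep p q"
  shows "least_chord p q \<le> k"
proof (cases "p \<le> 4 * q")
  case False
  then have "least_chord q p \<le> k"
    using assms unfolding sweep_commute[of p q] by (intro least_chord_le_aux) auto
  then show ?thesis unfolding least_chord_commute[OF assms(1,2)] .
qed (use least_chord_le_aux assms in blast)

text \<open>For fixed \<open>x\<close> the sum increases with \<open>p\<close> and \<open>q\<close>,
  so the minimiser for the larger pair already gives a small enough sum for the smaller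
  pair.\<close>

lemma least_chord_mono:
  assumes "0 < p" "p \<le> p'" "0 < q" "q \<le> q'"
  shows "least_chord p q \<le> least_chord p' q'"
proof -
  obtain x where x: "x \<in> {1/2..2}" "least_chord p' q' = (p' + q' + p' * x + q' / x) / 3"
    using least_chord_in_sweep[of p' q'] assms by (auto simp: sweep_def)
  have "least_chord p q \<le> (p + q + p * x + q / x) / 3"
    using assms x by (intro least_chord_le sweepI[of x]) auto
  also have "\<dots> \<le> (p' + q' + p' * x + q' / x) / 3"
    using assms x by (intro divide_right_mono add_mono mult_right_mono) auto
  finally show ?thesis using x by simp
qed

section \<open>Linear algebra of a nondegenerate triangle\<close>

text \<open>With a zero determinant, \<open>Q - V\<close> would equal its orthogonal projection onto
  \<open>P - V\<close>, making the points collinear. The next three lemmas solve linear systems with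
  this determinant.\<close>

lemma det_nonzero:
  fixes V P Q :: "real^2"
  assumes "\<not> collinear {V, P, Q}"
  shows "(P - V)$1 * (Q - V)$2 - (P - V)$2 * (Q - V)$1 \<noteq> 0"
proof
  assume D: "(P - V)$1 * (Q - V)$2 - (P - V)$2 * (Q - V)$1 = 0"
  have "{V, P, Q} = {V, Q, P}" by auto
  then have nc: "\<not> collinear {0, P - V, Q - V}"
    using assms collinear_3[of Q V P] by (simp add: insert_commute)
  define e f where "e = P - V" and "f = Q - V"
  have "e \<noteq> 0" using nc by (auto simp: collinear_lemma e_def)
  have "f = ((e \<bullet> f) / (e \<bullet> e)) *\<^sub>R e"
  proof -
    have "e $ 1 * f $ 2 = e $ 2 * f $ 1" using D by (simp add: e_def f_def)
    then have "(e \<bullet> e) * f $ 1 = (e \<bullet> f) * e $ 1" "(e \<bullet> e) * f $ 2 = (e \<bullet> f) * e $ 2"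
      by (simp_all add: inner_vec_def sum_2) algebra+
    then show ?thesis using \<open>e \<noteq> 0\<close> by (simp add: vec_eq_iff forall_2 field_simps)
  qed
  then show False using nc by (auto simp: collinear_lemma e_def[symmetric] f_def[symmetric])
qed

lemma noncollinear_independent:
  fixes V P Q :: "real^2"
  assumes "\<not> collinear {V, P, Q}" "\<alpha> *\<^sub>R (P - V) + \<beta> *\<^sub>R (Q - V) = 0"
  shows "\<alpha> = 0" "\<beta> = 0"
proof -
  define D where "D = (P - V)$1 * (Q - V)$2 - (P - V)$2 * (Q - V)$1"
  have e: "\<alpha> * (P - V)$1 + \<beta> * (Q - V)$1 = 0" "\<alpha> * (P - V)$2 + \<beta> * (Q - V)$2 = 0"
    using arg_cong[OF assms(2), of "\<lambda>v. v$1"] arg_cong[OF assms(2), of "\<lambda>v. v$2"] by simp_all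
  have "\<alpha> * D = 0" "\<beta> * D = 0" using e unfolding D_def by algebra+
  then show "\<alpha> = 0" "\<beta> = 0" using det_nonzero[OF assms(1)] by (auto simp: D_def)
qed

text \<open>Cramer's rule. It serves to realise an affine function with prescribed values at the
  vertices.\<close>

lemma inner_functional_exists:
  fixes V P Q :: "real^2"
  assumes "\<not> collinear {V, P, Q}"
  obtains n where "n \<bullet> (P - V) = \<alpha>" "n \<bullet> (Q - V) = \<beta>"
proof -
  define e f where "e = P - V" and "f = Q - V"
  define D where "D = e$1 * f$2 - e$2 * f$1"
  have D: "D \<noteq> 0" using det_nonzero[OF assms] by (simp add: D_def e_def f_def)
  define n :: "real^2" where
    "n = vector [(\<alpha> * f$2 - \<beta> * e$2) / D, (\<beta> * e$1 - \<alpha> * f$1) / D]"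
  have "n \<bullet> e = (\<alpha> * D) / D" "n \<bullet> f = (\<beta> * D) / D"
    by (simp_all add: n_def inner_vec_def sum_2 add_divide_distrib[symmetric] D_def algebra_simps)
  then show ?thesis using D that[of n] by (simp add: e_def f_def)
qed

lemma inner_functional_zero:
  fixes V P Q n :: "real^2"
  assumes "\<not> collinear {V, P, Q}" "n \<bullet> (P - V) = 0" "n \<bullet> (Q - V) = 0"
  shows "n = 0"
proof -
  define D where "D = (P - V)$1 * (Q - V)$2 - (P - V)$2 * (Q - V)$1"
  have e: "n$1 * (P - V)$1 + n$2 * (P - V)$2 = 0" "n$1 * (Q - V)$1 + n$2 * (Q - V)$2 = 0"
    using assms(2,3) by (simp_all add: inner_vec_def sum_2)
  have "n$1 * D = 0" "n$2 * D = 0" using e unfolding D_def by algebra+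
  then show ?thesis using det_nonzero[OF assms(1)] by (auto simp: D_def vec_eq_iff forall_2)
qed

section \<open>Chords through the centroid\<close>

text \<open>Let \<open>u\<close> be the position of the centroid on the chord from \<open>M\<close>
  to \<open>N\<close>. Comparing coefficients of the edge vectors gives
  \<open>(1 - u) * s = 1/3\<close> and \<open>u * t = 1/3\<close>, and the parameter is
  \<open>x = u / (1 - u)\<close>, the ratio in which the centroid divides the chord.\<close>

lemma corner_sums_eq_sweep:
  fixes V P Q :: "real^2"
  assumes "\<not> collinear {V, P, Q}"
  shows "corner_sums V P Q = sweep (dist V P) (dist V Q)"
proof (intro equalityI subsetI)
  fix k assume "k \<in> corner_sums V P Q"
  then obtain s t u where st: "0 \<le> s" "s \<le> 1" "0 \<le> t" "t \<le> 1" "0 \<le> u" "u \<le> 1"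
    and k: "k = dist V ((1 - s) *\<^sub>R V + s *\<^sub>R P) + dist V ((1 - t) *\<^sub>R V + t *\<^sub>R Q)"
    and G: "centroid V P Q =
      (1 - u) *\<^sub>R ((1 - s) *\<^sub>R V + s *\<^sub>R P) + u *\<^sub>R ((1 - t) *\<^sub>R V + t *\<^sub>R Q)"
    unfolding corner_sums_def in_segment by blast
  have "(1/3 - (1 - u) * s) *\<^sub>R (P - V) + (1/3 - u * t) *\<^sub>R (Q - V) = 0"
  proof -
    have "(1/3 - (1 - u) * s) *\<^sub>R (P - V) + (1/3 - u * t) *\<^sub>R (Q - V) = centroid V P Q -
      ((1 - u) *\<^sub>R ((1 - s) *\<^sub>R V + s *\<^sub>R P) + u *\<^sub>R ((1 - t) *\<^sub>R V + t *\<^sub>R Q))"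
      by (simp add: centroid_def vec_eq_iff algebra_simps)
    then show ?thesis using G by simp
  qed
  from noncollinear_independent[OF assms this]
  have us: "(1 - u) * s = 1/3" and ut: "u * t = 1/3" by auto
  \<comment> \<open>The endpoints stay on their sides, so \<open>s\<close> and \<open>t\<close> are
    at most 1; this confines \<open>u\<close> and hence \<open>x\<close>.\<close>
  have u: "1/3 \<le> u" "u \<le> 2/3"
    using us ut st mult_left_mono[of t 1 u] mult_left_mono[of s 1 "1 - u"] by auto
  have "V - ((1 - s) *\<^sub>R V + s *\<^sub>R P) = s *\<^sub>R (V - P)"
    "V - ((1 - t) *\<^sub>R V + t *\<^sub>R Q) = t *\<^sub>R (V - Q)"
    by (simp_all add: algebra_simps)
  then have k': "k = s * dist V P + t * dist V Q"
    using k st by (simp add: dist_norm)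
  have s: "s = 1 / (3 * (1 - u))" and t: "t = 1 / (3 * u)"
    using us ut u by (simp_all add: field_simps)
  show "k \<in> sweep (dist V P) (dist V Q)"
  proof (rule sweepI[of "u / (1 - u)"])
    show "u / (1 - u) \<in> {1/2..2}" using u by (simp add: field_simps)
    show "k = (dist V P + dist V Q + dist V P * (u / (1 - u)) + dist V Q / (u / (1 - u))) / 3"
      using u by (simp add: k' s t field_simps)
  qed
next
  fix k assume "k \<in> sweep (dist V P) (dist V Q)"
  then obtain x where x: "1/2 \<le> x" "x \<le> 2"
    and k: "k = (dist V P + dist V Q + dist V P * x + dist V Q / x) / 3"
    by (auto simp: sweep_def)
  define s t u where "s = (1 + x) / 3" and "t = (1 + 1 / x) / 3" and "u = x / (1 + x)"
  have st: "0 \<le> s" "s \<le> 1" "0 \<le> t" "t \<le> 1" "0 \<le> u" "u \<le> 1"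
    using x by (auto simp: s_def t_def u_def field_simps)
  define M N where "M = (1 - s) *\<^sub>R V + s *\<^sub>R P" and "N = (1 - t) *\<^sub>R V + t *\<^sub>R Q"
  have M: "M \<in> closed_segment V P" and N: "N \<in> closed_segment V Q"
    using st unfolding in_segment M_def N_def by blast+
  have us: "(1 - u) * s = 1/3" and ut: "u * t = 1/3"
  proof -
    have nz: "x \<noteq> 0" "1 + x \<noteq> 0" using x by auto
    then have "1 - u = 1 / (1 + x)" "t = (1 + x) / (3 * x)"
      by (simp_all add: u_def t_def field_simps)
    then show "(1 - u) * s = 1/3" "u * t = 1/3" using nz by (simp_all add: s_def u_def)
  qed
  have "(1 - u) *\<^sub>R M + u *\<^sub>R N =
      (1 - (1 - u) * s - u * t) *\<^sub>R V + ((1 - u) * s) *\<^sub>R P + (u * t) *\<^sub>R Q"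
    by (simp add: M_def N_def algebra_simps)
  then have "centroid V P Q = (1 - u) *\<^sub>R M + u *\<^sub>R N"
    unfolding us ut by (simp add: centroid_def algebra_simps)
  then have G: "centroid V P Q \<in> closed_segment M N"
    using st unfolding in_segment by blast
  have "V - M = s *\<^sub>R (V - P)" "V - N = t *\<^sub>R (V - Q)"
    by (simp_all add: M_def N_def algebra_simps)
  then have "k = dist V M + dist V N"
    using st by (simp add: k dist_norm) (simp add: s_def t_def algebra_simps add_divide_distrib)
  then show "k \<in> corner_sums V P Q"
    using M N G unfolding corner_sums_def by blast
qed

section \<open>Lengths and components of the perimeter cut by a line\<close>

text \<open>An affine function changes sign at most once on the unit interval, so by the signs of
  its end values the set is the whole interval, empty, an initial interval or a final one.\<close>

lemma measure_positive_fraction: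
  "measure lborel {t \<in> {0..1}. (1 - t) * x + t * y > 0} = positive_fraction x y"
proof -
  consider "x > 0" "y > 0" | "x \<le> 0" "y \<le> 0" | "x > 0" "y \<le> 0" | "x \<le> 0" "y > 0" by linarith
  then show ?thesis
  proof cases
    case 1
    have "(1 - t) * x + t * y > 0" if "0 \<le> t" "t \<le> 1" for t
    proof (cases "t = 0")
      case False
      then show ?thesis using 1 that by (intro add_nonneg_pos mult_nonneg_nonneg mult_pos_pos) auto
    qed (use 1 in simp)
    then have "{t \<in> {0..1}. (1 - t) * x + t * y > 0} = {0..1}" by auto
    then show ?thesis using 1 by (simp add: positive_fraction_def)
  next
    case 2
    have "(1 - t) * x + t * y \<le> 0" if "0 \<le> t" "t \<le> 1" for t
      using 2 that by (intro add_nonpos_nonpos mult_nonneg_nonpos) auto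
    then have *: "{t \<in> {0..1}. (1 - t) * x + t * y > 0} = {}" by fastforce
    show ?thesis unfolding * using 2 by (simp add: positive_fraction_def)
  next
    case 3
    have "(1 - t) * x + t * y > 0 \<longleftrightarrow> t < x / (x - y)" for t
      using 3 by (simp add: pos_less_divide_eq algebra_simps)
    moreover have "x / (x - y) \<le> 1" using 3 by simp
    ultimately have "t \<in> {0..1} \<and> (1 - t) * x + t * y > 0 \<longleftrightarrow> t \<in> {0..<x / (x - y)}" for t
      unfolding atLeastAtMost_iff atLeastLessThan_iff by (meson less_imp_le less_le_trans)
    then have "{t \<in> {0..1}. (1 - t) * x + t * y > 0} = {0..<x / (x - y)}"
      by (intro set_eqI) (simp only: mem_Collect_eq)
    then show ?thesis using 3 by (simp add: positive_fraction_def)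
  next
    case 4
    have "(1 - t) * x + t * y > 0 \<longleftrightarrow> - x / (y - x) < t" for t
      using 4 by (simp add: pos_divide_less_eq algebra_simps del: divide_minus_left)
    moreover have "0 \<le> - x / (y - x)" using 4 by (intro divide_nonneg_pos) auto
    ultimately have "t \<in> {0..1} \<and> (1 - t) * x + t * y > 0 \<longleftrightarrow> t \<in> {- x / (y - x)<..1}" for t
      unfolding atLeastAtMost_iff greaterThanAtMost_iff by (meson less_imp_le le_less_trans)
    then have "{t \<in> {0..1}. (1 - t) * x + t * y > 0} = {- x / (y - x)<..1}"
      by (intro set_eqI) (simp only: mem_Collect_eq)
    moreover have "- x / (y - x) \<le> 1" "1 + x / (y - x) = y / (y - x)"
      using 4 by (auto simp: field_simps)
    ultimately show ?thesis using 4 by (simp add: positive_fraction_def)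
  qed
qed

lemma length_on_side_halfplane:
  fixes P Q n :: "real^2"
  assumes "closed_segment P Q \<subseteq> E"
  shows "length_on_side P Q {x \<in> E. n \<bullet> x > d} =
    dist P Q * positive_fraction (n \<bullet> P - d) (n \<bullet> Q - d)"
proof -
  have "linepath P Q t \<in> E" if "0 \<le> t" "t \<le> 1" for t
    using assms that linepath_in_path by fastforce
  moreover have "n \<bullet> linepath P Q t - d = (1 - t) * (n \<bullet> P - d) + t * (n \<bullet> Q - d)" for t
    by (simp add: linepath_def inner_simps algebra_simps)
  ultimately have "{t \<in> {0..1}. linepath P Q t \<in> {x \<in> E. n \<bullet> x > d}} =
      {t \<in> {0..1}. (1 - t) * (n \<bullet> P - d) + t * (n \<bullet> Q - d) > 0}"
    by (smt (verit) Collect_cong atLeastAtMost_iff mem_Collect_eq)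
  then show ?thesis by (simp only: length_on_side_def measure_positive_fraction)
qed

text \<open>Each side meets the open half-plane in a convex set. If a vertex lies in the half-plane,
  its two sides are joined there; the third side is joined at another vertex in the half-plane, or
  misses the half-plane altogether.\<close>

lemma connected_perimeter_halfplane:
  fixes A B C n :: "real^2"
  shows "connected {x \<in> perimeter A B C. n \<bullet> x > d}"
proof -
  define H where "H = {x. n \<bullet> x > d}"
  have con: "connected (closed_segment P Q \<inter> H)" for P Q :: "real^2"
    unfolding H_def by (intro convex_connected convex_Int convex_closed_segment convex_halfspace_gt)
  have empty: "closed_segment P Q \<inter> H = {}" if "P \<notin> H" "Q \<notin> H" for P Q
  proof -
    have "closed_segment P Q \<subseteq> {x. n \<bullet> x \<le> d}"
      using that by (intro closed_segment_subset convex_halfspace_le) (auto simp: H_def)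
    then show ?thesis by (auto simp: H_def)
  qed
  have vertex: "connected (closed_segment V P \<inter> H \<union> closed_segment Q V \<inter> H \<union> closed_segment P Q \<inter> H)"
    if "V \<in> H" for V P Q
  proof -
    have VU: "connected (closed_segment V P \<inter> H \<union> closed_segment Q V \<inter> H)"
      using that by (intro connected_Un con) auto
    show ?thesis
    proof (cases "P \<in> H \<or> Q \<in> H")
      case True
      then show ?thesis by (intro connected_Un[OF VU con]) auto
    next
      case False
      then show ?thesis using VU empty[of P Q] by simp
    qed
  qed
  have eq: "{x \<in> perimeter A B C. n \<bullet> x > d} =
      closed_segment A B \<inter> H \<union> closed_segment B C \<inter> H \<union> closed_segment C A \<inter> H"
    by (auto simp: perimeter_def H_def)
  consider "A \<in> H" | "B \<in> H" | "C \<in> H" | "A \<notin> H" "B \<notin> H" "C \<notin> H" by blast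
  then show ?thesis
  proof cases
    case 1 show ?thesis unfolding eq using vertex[OF 1, of B C] by (simp add: Un_ac)
  next
    case 2 show ?thesis unfolding eq using vertex[OF 2, of C A] by (simp add: Un_ac)
  next
    case 3 show ?thesis unfolding eq using vertex[OF 3, of A B] by (simp add: Un_ac)
  next
    case 4 show ?thesis unfolding eq using 4 by (simp add: empty)
  qed
qed


text \<open>Both open half-planes cut out connected pieces, and a connected set meeting both would
  meet the line. The empty set is removed because a general line may have no perimeter points on one
  side.\<close>

lemma components_perimeter_hyperplane:
  fixes A B C n :: "real^2" and d :: real
  defines "X \<equiv> {x \<in> perimeter A B C. n \<bullet> x > d}"
    and "Y \<equiv> {x \<in> perimeter A B C. n \<bullet> x < d}"
  shows "components (perimeter A B C - {x. n \<bullet> x = d}) = {X, Y} - {{}}"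
proof -
  have conX: "connected X" unfolding X_def by (rule connected_perimeter_halfplane)
  have "Y = {x \<in> perimeter A B C. - n \<bullet> x > - d}" by (auto simp: Y_def)
  then have conY: "connected Y" by (metis connected_perimeter_halfplane)
  have XY: "perimeter A B C - {x. n \<bullet> x = d} = X \<union> Y" by (auto simp: X_def Y_def)
  have no_d: "n \<bullet> x \<noteq> d" if "x \<in> X \<union> Y" for x using that by (auto simp: X_def Y_def)
  have dich: "S \<subseteq> X \<or> S \<subseteq> Y" if S: "connected S" "S \<subseteq> X \<union> Y" for S
  proof (rule ccontr)
    assume "\<not> (S \<subseteq> X \<or> S \<subseteq> Y)"
    then obtain x y where "x \<in> S" "x \<in> Y" "y \<in> S" "y \<in> X" using S by blast
    then obtain z where "z \<in> S" "n \<bullet> z = d"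
      using connected_ivt_hyperplane[OF S(1), of x y n d] by (auto simp: X_def Y_def)
    then show False using S no_d by blast
  qed
  have disj: "X \<inter> Y = {}" by (auto simp: X_def Y_def)
  show ?thesis
  proof (intro equalityI subsetI)
    fix S assume "S \<in> components (perimeter A B C - {x. n \<bullet> x = d})"
    then have S: "S \<noteq> {}" "S \<subseteq> X \<union> Y" "connected S"
      and max: "\<And>D. D \<noteq> {} \<Longrightarrow> S \<subseteq> D \<Longrightarrow> D \<subseteq> X \<union> Y \<Longrightarrow> connected D \<Longrightarrow> D = S"
      unfolding in_components_maximal XY by blast+
    then show "S \<in> {X, Y} - {{}}"
      using dich[OF S(3,2)] max[of X] max[of Y] conX conY by blast
  next
    fix S assume "S \<in> {X, Y} - {{}}"
    then show "S \<in> components (perimeter A B C - {x. n \<bullet> x = d})"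
      unfolding in_components_maximal XY using dich conX conY disj by blast
  qed
qed

lemma perimeter_length_halfplane:
  fixes A B C n :: "real^2"
  shows "perimeter_length A B C {x \<in> perimeter A B C. n \<bullet> x > d} =
    dist A B * positive_fraction (n \<bullet> A - d) (n \<bullet> B - d) +
    dist B C * positive_fraction (n \<bullet> B - d) (n \<bullet> C - d) +
    dist C A * positive_fraction (n \<bullet> C - d) (n \<bullet> A - d)"
proof -
  have "closed_segment A B \<subseteq> perimeter A B C" "closed_segment B C \<subseteq> perimeter A B C"
    "closed_segment C A \<subseteq> perimeter A B C"
    by (auto simp: perimeter_def)
  then show ?thesis by (simp only: perimeter_length_def length_on_side_halfplane)
qed

text \<open>The numbers \<open>x, y, z\<close> are the values at the vertices of an affine function vanishing on
  the dividing line. They add up to zero because the line passes through the centroid, and the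
  part considered is the one where the function is positive.\<close>

lemma part_lengths_eq:
  fixes A B C :: "real^2"
  assumes nc: "\<not> collinear {A, B, C}"
  shows "part_lengths A B C =
    {dist A B * positive_fraction x y + dist B C * positive_fraction y z +
      dist C A * positive_fraction z x | x y z. x + y + z = 0 \<and> (x, y, z) \<noteq> (0, 0, 0)}"
    (is "_ = {?f x y z | x y z. ?P x y z}")
proof (intro equalityI subsetI)
  fix k assume "k \<in> part_lengths A B C"
  then obtain L S where L: "affine L" "aff_dim L = 1" "centroid A B C \<in> L"
    and S: "S \<in> components (perimeter A B C - L)" and k: "k = perimeter_length A B C S"
    unfolding part_lengths_def by blast
  \<comment> \<open>In the plane, dimension 1 means a hyperplane, so the line has a normal
    vector.\<close>
  obtain n d where n: "n \<noteq> 0" and "affine hull L = {x. n \<bullet> x = d}"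
    using L(2) aff_dim_eq_hyperplane[of L] by auto
  then have Ld: "L = {x. n \<bullet> x = d}" using L(1) by (simp add: hull_same)
  have P: "?P (m \<bullet> A - e) (m \<bullet> B - e) (m \<bullet> C - e)"
    if "m \<noteq> 0" "m \<bullet> centroid A B C = e" for m e
  proof -
    have "(m \<bullet> A - e) + (m \<bullet> B - e) + (m \<bullet> C - e) = 0"
      using that(2) by (simp add: centroid_def inner_simps)
    moreover have "(m \<bullet> A - e, m \<bullet> B - e, m \<bullet> C - e) \<noteq> (0, 0, 0)"
      using inner_functional_zero[OF nc, of m] that(1) by (auto simp: inner_simps)
    ultimately show ?thesis by blast
  qed
  have nG: "n \<bullet> centroid A B C = d" using L(3) Ld by simp
  \<comment> \<open>Negating \<open>n\<close> and \<open>d\<close> turns the negative component into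
    a positive one, so one formula covers both.\<close>
  have "S = {x \<in> perimeter A B C. n \<bullet> x > d} \<or> S = {x \<in> perimeter A B C. (- n) \<bullet> x > - d}"
    using S unfolding Ld components_perimeter_hyperplane by auto
  then show "k \<in> {?f x y z | x y z. ?P x y z}"
  proof
    assume "S = {x \<in> perimeter A B C. n \<bullet> x > d}"
    then show ?thesis using P[OF n nG] unfolding k by (auto simp only: perimeter_length_halfplane)
  next
    assume "S = {x \<in> perimeter A B C. (- n) \<bullet> x > - d}"
    moreover have "- n \<noteq> 0" "(- n) \<bullet> centroid A B C = - d" using n nG by auto
    ultimately show ?thesis using P[of "- n" "- d"] unfolding k
      by (auto simp only: perimeter_length_halfplane)
  qed
next
  fix k assume "k \<in> {?f x y z | x y z. ?P x y z}"
  then obtain x y z where k: "k = ?f x y z" and xyz: "x + y + z = 0" "(x, y, z) \<noteq> (0, 0, 0)"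
    by blast
  obtain n where n: "n \<bullet> (B - A) = y - x" "n \<bullet> (C - A) = z - x"
    using inner_functional_exists[OF nc] by blast
  define d where "d = n \<bullet> A - x"
  have h: "n \<bullet> A - d = x" "n \<bullet> B - d = y" "n \<bullet> C - d = z"
    using n by (simp_all add: d_def inner_simps)
  define S where "S = {v \<in> perimeter A B C. n \<bullet> v > d}"
  have "n \<noteq> 0" using h xyz by auto
  then have "aff_dim {v. n \<bullet> v = d} = 1" by simp
  moreover have "centroid A B C \<in> {v. n \<bullet> v = d}"
    using h xyz by (simp add: centroid_def inner_simps)
  moreover have "S \<noteq> {}"
  proof -
    have "A \<in> perimeter A B C" "B \<in> perimeter A B C" "C \<in> perimeter A B C"
      by (auto simp: perimeter_def)
    moreover have "x > 0 \<or> y > 0 \<or> z > 0" using xyz by auto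
    ultimately have "A \<in> S \<or> B \<in> S \<or> C \<in> S" using h by (auto simp: S_def)
    then show ?thesis by blast
  qed
  then have "S \<in> components (perimeter A B C - {v. n \<bullet> v = d})"
    unfolding components_perimeter_hyperplane S_def by blast
  moreover have "k = perimeter_length A B C S"
    unfolding k S_def perimeter_length_halfplane h ..
  ultimately show "k \<in> part_lengths A B C"
    unfolding part_lengths_def using affine_hyperplane by blast
qed

section \<open>Comparison of perimeter parts with corner sums\<close>

lemma positive_fraction_commute: "positive_fraction x y = positive_fraction y x"
  by (simp add: positive_fraction_def add.commute)

text \<open>Only the vertex with value \<open>x\<close> lies on the positive side, so the cut ratios
  are \<open>x / (x - y)\<close> and \<open>x / (x - z)\<close>. Since the values sum to zero,
  \<open>3 * x = (x - y) + (x - z)\<close>, which makes \<open>u\<close> the sweep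
  parameter.\<close>

lemma corner_part_in_sweep:
  assumes "x > 0" "y \<le> 0" "z \<le> 0" "x + y + z = 0"
  shows "p * positive_fraction x y + q * positive_fraction x z + r * positive_fraction y z \<in> sweep p q"
proof -
  define u v where "u = (x - z) / (x - y)" and "v = (x - y) / (x - z)"
  have sum: "3 * x = (x - y) + (x - z)" "3 * x = (x - z) + (x - y)" using assms by auto
  have uv: "1 + u = 3 * (x / (x - y))" "1 + v = 3 * (x / (x - z))"
    using assms unfolding u_def v_def times_divide_eq_right sum add_divide_distrib by auto
  have third: "r = (1 + w) / 3" if "1 + w = 3 * r" for r w :: real using that by simp
  have "positive_fraction x y = x / (x - y)" "positive_fraction x z = x / (x - z)"
    using assms by (auto simp: positive_fraction_def)
  then have pf: "positive_fraction x y = (1 + u) / 3" "positive_fraction x z = (1 + v) / 3"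
    by (simp_all only: third[OF uv(1)] third[OF uv(2)])
  have pf0: "positive_fraction y z = 0" using assms by (simp add: positive_fraction_def)
  show ?thesis unfolding pf pf0
  proof (rule sweepI[of u])
    show "u \<in> {1/2..2}" using assms by (simp add: u_def field_simps)
    have "q / u = q * v" by (simp add: u_def v_def)
    then show "p * ((1 + u) / 3) + q * ((1 + v) / 3) + r * 0 = (p + q + p * u + q / u) / 3"
      by (simp add: field_simps)
  qed
qed

text \<open>The part contains the whole side \<open>r\<close>. Its fractions of the other two sides
  add up to at least 1/2, the limiting value as the line turns into a median.\<close>

lemma opposite_part_ge_median:
  assumes "x < 0" "y > 0" "z > 0" "x + y + z = 0" "p > 0" "q > 0"
  shows "min (r + p / 2) (r + q / 2) \<le>
    p * positive_fraction x y + q * positive_fraction x z + r * positive_fraction y z"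
proof -
  have pf: "positive_fraction x y = y / (2 * y + z)" "positive_fraction x z = z / (y + 2 * z)"
    "positive_fraction y z = 1"
    using assms by (auto simp: positive_fraction_def)
  have "min p q / 2 \<le> min p q * (y / (2 * y + z) + z / (y + 2 * z))"
  proof -
    have "1 / 2 \<le> y / (2 * y + z) + z / (y + 2 * z)"
    proof -
      have "y / (2 * y + z) + z / (y + 2 * z) =
          (y * (y + 2 * z) + z * (2 * y + z)) / ((2 * y + z) * (y + 2 * z))"
        using assms by (intro add_frac_eq) auto
      \<comment> \<open>After clearing denominators the difference is
        \<open>3/2 * (y * z)\<close>.\<close>
      moreover have "0 < y * z" using assms by simp
      then have "1 / 2 * ((2 * y + z) * (y + 2 * z)) \<le> y * (y + 2 * z) + z * (2 * y + z)"
        by (simp add: algebra_simps)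
      ultimately show ?thesis using assms by (simp add: pos_le_divide_eq)
    qed
    then show ?thesis using mult_left_mono[of "1/2" _ "min p q"] assms by simp
  qed
  also have "\<dots> \<le> p * (y / (2 * y + z)) + q * (z / (y + 2 * z))"
    unfolding distrib_left using assms by (intro add_mono mult_right_mono) auto
  finally show ?thesis unfolding pf by (auto simp: min_def split: if_splits)
qed

text \<open>The vertex with value \<open>x\<close> is alone on its side of the line, zero values
  counting as negative; \<open>p\<close> and \<open>q\<close> are its sides. If it is positive, the
  part is a corner sum there; if negative, the median bound gives corner sums at the other two
  vertices.\<close>

lemma part_length_ge_least_chord:
  assumes "x > 0 \<and> y \<le> 0 \<and> z \<le> 0 \<or> x < 0 \<and> y > 0 \<and> z > 0" "x + y + z = 0"
    and pos: "p > 0" "q > 0" "r > 0"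
  shows "min (least_chord p q) (min (least_chord p r) (least_chord q r)) \<le>
    p * positive_fraction x y + q * positive_fraction x z + r * positive_fraction y z"
  using assms(1)
proof (elim disjE conjE)
  assume "x > 0" "y \<le> 0" "z \<le> 0"
  then show ?thesis
    using least_chord_le[OF pos(1,2) corner_part_in_sweep[of x y z p q r]] assms by auto
next
  assume "x < 0" "y > 0" "z > 0"
  then have "min (r + p / 2) (r + q / 2) \<le>
      p * positive_fraction x y + q * positive_fraction x z + r * positive_fraction y z"
    using assms by (intro opposite_part_ge_median) auto
  moreover have "least_chord p r \<le> r + p / 2" "least_chord q r \<le> r + q / 2"
    using median_in_sweep pos by (auto intro!: least_chord_le simp: add.commute)
  ultimately show ?thesis by linarith
qed

lemma sweep_subset_part_lengths:
  fixes A B C :: "real^2"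
  assumes "\<not> collinear {A, B, C}"
  shows "sweep (dist A B) (dist C A) \<subseteq> part_lengths A B C"
proof
  fix k assume "k \<in> sweep (dist A B) (dist C A)"
  then obtain t where t: "1/2 \<le> t" "t \<le> 2"
    and k: "k = (dist A B + dist C A + dist A B * t + dist C A / t) / 3"
    by (auto simp: sweep_def)
  \<comment> \<open>With value 1 at \<open>A\<close>, \<open>y\<close> solves
    \<open>1 / (1 - y) = (1 + t) / 3\<close>, the required cut ratio on \<open>AB\<close>; zero sum
    then determines \<open>z\<close>.\<close>
  define y z where "y = (t - 2) / (1 + t)" and "z = (1 - 2 * t) / (1 + t)"
  have yz: "y \<le> 0" "z \<le> 0" "1 + y + z = 0"
    using t by (auto simp: y_def z_def field_simps)
  have "1 - y = 3 / (1 + t)" "1 - z = 3 * t / (1 + t)"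
    using t by (simp_all add: y_def z_def field_simps)
  then have pf: "positive_fraction 1 y = (1 + t) / 3" "positive_fraction z 1 = (1 + t) / (3 * t)"
    "positive_fraction y z = 0"
    using yz by (auto simp: positive_fraction_def)
  have "k = dist A B * positive_fraction 1 y + dist B C * positive_fraction y z +
      dist C A * positive_fraction z 1"
    unfolding k pf using t by (simp add: field_simps)
  then show "k \<in> part_lengths A B C"
    unfolding part_lengths_eq[OF assms] using yz by force
qed

lemma part_lengths_rotate: "part_lengths A B C = part_lengths B C A"
proof -
  have "perimeter B C A = perimeter A B C" "centroid B C A = centroid A B C"
    by (auto simp: perimeter_def centroid_def algebra_simps)
  then show ?thesis by (simp add: part_lengths_def perimeter_length_def add_ac)
qed

section \<open>The minima and their comparison\<close>

lemma minimum_corner_sums: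
  fixes V P Q :: "real^2"
  assumes "\<not> collinear {V, P, Q}"
  shows "has_minimum (corner_sums V P Q)"
    "minimum (corner_sums V P Q) = least_chord (dist V P) (dist V Q)"
proof -
  have "V \<noteq> P" "V \<noteq> Q" using assms by (auto simp: insert_commute)
  then have "0 < dist V P" "0 < dist V Q" by auto
  then show "has_minimum (corner_sums V P Q)"
    "minimum (corner_sums V P Q) = least_chord (dist V P) (dist V Q)"
    unfolding corner_sums_eq_sweep[OF assms]
    using least_chord_in_sweep least_chord_le minimum_eqI by meson+
qed

lemma minimum_part_lengths:
  fixes A B C :: "real^2"
  assumes nc: "\<not> collinear {A, B, C}"
  defines "a \<equiv> dist B C" and "b \<equiv> dist A C" and "c \<equiv> dist A B"
  defines "m \<equiv> min (least_chord b c) (min (least_chord a c) (least_chord a b))"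
  shows "has_minimum (part_lengths A B C)" "minimum (part_lengths A B C) = m"
proof -
  have "A \<noteq> B" "B \<noteq> C" "A \<noteq> C" using nc by (auto simp: insert_commute)
  then have pos: "a > 0" "b > 0" "c > 0" by (auto simp: a_def b_def c_def)
  have rot: "\<not> collinear {B, C, A}" "\<not> collinear {C, A, B}"
    using nc by (simp_all add: insert_commute)
  have "least_chord b c \<in> part_lengths A B C"
    using sweep_subset_part_lengths[OF nc] least_chord_in_sweep[OF pos(2,3)]
    by (auto simp: b_def c_def dist_commute sweep_commute)
  moreover have "least_chord a c \<in> part_lengths A B C"
    using sweep_subset_part_lengths[OF rot(1)] least_chord_in_sweep[OF pos(1,3)]
    by (auto simp: a_def c_def dist_commute part_lengths_rotate[of A])
  moreover have "least_chord a b \<in> part_lengths A B C"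
    using sweep_subset_part_lengths[OF rot(2)] least_chord_in_sweep[OF pos(1,2)]
    by (auto simp: a_def b_def dist_commute sweep_commute part_lengths_rotate[of C])
  ultimately have mem: "m \<in> part_lengths A B C" by (auto simp: m_def min_def)
  have le: "m \<le> k" if part: "k \<in> part_lengths A B C" for k
  proof -
    obtain x y z where xyz: "x + y + z = 0" "(x, y, z) \<noteq> (0, 0, 0)"
      and k: "k = c * positive_fraction x y + a * positive_fraction y z + b * positive_fraction z x"
      using part unfolding part_lengths_eq[OF nc] a_def b_def c_def dist_commute[of A C] by blast
    note comm = positive_fraction_commute[of z x] positive_fraction_commute[of z y]
      positive_fraction_commute[of y x] least_chord_commute[OF pos(1,2)]
      least_chord_commute[OF pos(1,3)] least_chord_commute[OF pos(2,3)]
    \<comment> \<open>The values sum to zero without all vanishing, so they are neither all positive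
      nor all nonpositive: exactly one vertex is alone in its class.\<close>
    consider "x > 0 \<and> y \<le> 0 \<and> z \<le> 0 \<or> x < 0 \<and> y > 0 \<and> z > 0"
      | "y > 0 \<and> x \<le> 0 \<and> z \<le> 0 \<or> y < 0 \<and> x > 0 \<and> z > 0"
      | "z > 0 \<and> x \<le> 0 \<and> y \<le> 0 \<or> z < 0 \<and> x > 0 \<and> y > 0"
      using xyz by (smt (verit))
    then show ?thesis
    proof cases
      case 1
      from part_length_ge_least_chord[OF this _ pos(3,2,1)] xyz comm
      show ?thesis by (simp add: k m_def min.commute min.left_commute add_ac)
    next
      case 2
      from part_length_ge_least_chord[OF this _ pos(3,1,2)] xyz comm
      show ?thesis by (simp add: k m_def min.commute min.left_commute add_ac)
    next
      case 3
      from part_length_ge_least_chord[OF this _ pos(2,1,3)] xyz comm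
      show ?thesis by (simp add: k m_def min.commute min.left_commute add_ac)
    qed
  qed
  show "has_minimum (part_lengths A B C)" "minimum (part_lengths A B C) = m"
    using minimum_eqI[OF mem le] by auto
qed

theorem theorem4:
  fixes A B C :: "real^2" and a b c w wA wB wC :: real
  assumes nondegenerate: "\<not> collinear {A, B, C}"
    and "a = dist B C" and "b = dist A C" and "c = dist A B"
    and "wA = minimum (corner_sums A B C)"
    and "wB = minimum (corner_sums B A C)"
    and "wC = minimum (corner_sums C A B)"
    and "w = minimum (part_lengths A B C)"
  shows
    "(has_minimum (corner_sums A B C) \<and> has_minimum (corner_sums B A C) \<and>
      has_minimum (corner_sums C A B) \<and> has_minimum (part_lengths A B C)) \<and>
     (a \<ge> b \<and> b \<ge> c \<longrightarrow>
        wA = (if b \<le> 4 * c then b / 3 + c / 3 + 2 * sqrt (b * c) / 3 else c + b / 2) \<and>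
        wB = (if a \<le> 4 * c then a / 3 + c / 3 + 2 * sqrt (a * c) / 3 else c + a / 2) \<and>
        wC = a / 3 + b / 3 + 2 * sqrt (a * b) / 3) \<and>
     (a \<ge> b \<and> b \<ge> c \<longrightarrow> wA \<le> wB \<and> wB \<le> wC \<and> w = wA) \<and>
     (w \<le> 4 * (a + b + c) / 9 \<and> (w = 4 * (a + b + c) / 9 \<longleftrightarrow> a = b \<and> b = c))"
proof -
  have "A \<noteq> B" "B \<noteq> C" "A \<noteq> C" using nondegenerate by (auto simp: insert_commute)
  then have pos: "a > 0" "b > 0" "c > 0" by (auto simp: assms)
  have nc: "\<not> collinear {B, A, C}" "\<not> collinear {C, A, B}"
    using nondegenerate by (simp_all add: insert_commute)
  have has: "has_minimum (corner_sums A B C)" "has_minimum (corner_sums B A C)"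
    "has_minimum (corner_sums C A B)" "has_minimum (part_lengths A B C)"
    using minimum_corner_sums minimum_part_lengths nondegenerate nc by blast+
  have W: "wA = least_chord b c" "wB = least_chord a c" "wC = least_chord a b"
    using minimum_corner_sums(2)[OF nondegenerate] minimum_corner_sums(2)[OF nc(1)]
      minimum_corner_sums(2)[OF nc(2)] least_chord_commute pos
    unfolding assms by (simp_all add: dist_commute)
  have w: "w = min wA (min wB wC)"
    unfolding W using minimum_part_lengths(2)[OF nondegenerate] by (simp add: assms)
  \<comment> \<open>With \<open>b \<ge> c\<close> this gives \<open>a \<le> 2 * b\<close>, so the
    endpoint branches never occur for \<open>wC\<close>.\<close>
  have tri: "a \<le> b + c" using dist_triangle[of B C A] by (simp add: assms dist_commute)
  have formulas: "wA = (if b \<le> 4 * c then b / 3 + c / 3 + 2 * sqrt (b * c) / 3 else c + b / 2)"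
    "wB = (if a \<le> 4 * c then a / 3 + c / 3 + 2 * sqrt (a * c) / 3 else c + a / 2)"
    "wC = a / 3 + b / 3 + 2 * sqrt (a * b) / 3" if "a \<ge> b" "b \<ge> c"
    using that pos tri unfolding W by (auto simp: least_chord_def)
  have order: "wA \<le> wB" "wB \<le> wC" if "a \<ge> b" "b \<ge> c"
    unfolding W using that pos by (auto intro!: least_chord_mono)
  have le: "wA \<le> 2 * (b + c) / 3" "wB \<le> 2 * (a + c) / 3" "wC \<le> 2 * (a + b) / 3"
    unfolding W using pos by (simp_all only: least_chord_le[OF _ _ parallel_in_sweep])
  \<comment> \<open>The sum of these bounds is three times the bound in (iii). Equality there forces
    equality in all three, hence equal pairwise sums of sides.\<close>
  have w_le: "w \<le> 2 * (b + c) / 3" "w \<le> 2 * (a + c) / 3" "w \<le> 2 * (a + b) / 3"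
    using le w by auto
  then have bound: "w \<le> 4 * (a + b + c) / 9" by simp
  have "w = 4 * (a + b + c) / 9 \<longleftrightarrow> a = b \<and> b = c"
  proof
    assume "w = 4 * (a + b + c) / 9"
    then show "a = b \<and> b = c" using w_le by simp
  next
    assume eq: "a = b \<and> b = c"
    then have "wA = 4 * a / 3" "wB = 4 * a / 3" "wC = 4 * a / 3"
      using formulas pos by auto
    then show "w = 4 * (a + b + c) / 9" using w eq by simp
  qed
  then show ?thesis using has formulas order bound w by auto
qed

end
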